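(* Assume that $f(\bm{x})=\sum_{i=1}^N f_i(x_i)$ is $c_0$-strongly convex on $\mathbb{R}^{nN}$ for some $c_0>0$ and twice continuously differentiable, and that the graph $\mathcal{G}$ with Laplacian $L$ is strongly connected and weight-balanced; let $\bm{L}=L\otimes I_n$. Let $\bm{x}^*,\bm{\lambda}^*,\bm{\lambda}_0,k_1,\delta,\varepsilon_0$ be as defined in the context, and for $\varepsilon\in(0,\varepsilon_0)$ let $(\bar{\bm{x}}(\varepsilon),\bar{\bm{\lambda}}(\varepsilon))$ be the unique equilibrium of $$\dot{\bm{x}}=-\nabla f(\bm{x})-\bm{\lambda},\qquad \varepsilon\dot{\bm{\lambda}}=-\bm{L}\bm{\lambda}+\varepsilon(\bm{x}-\bm{b}).$$ Then $(\bar{\bm{x}}(\varepsilon),\bar{\bm{\lambda}}(\varepsilon))$ is a sub-optimal solution of the problem of minimizing $f(\bm{x})$ subject to $(1_N^T\otimes I_n)\bm{x}=d$, in the sense that $$(1_N^T\otimes I_n)\bar{\bm{x}}(\varepsilon)=d\quad\text{for all }\varepsilon\in(0,\varepsilon_0),\qquad \lim_{\varepsilon\to0^+}(\bar{\bm{x}}(\varepsilon),\bar{\bm{\lambda}}(\varepsilon))=(\bm{x}^*,\bm{\lambda}^* ).$$ Moreover, for any $\varepsilon\in(0,\varepsilon_0)$, $$\|\bar{\bm{x}}(\varepsilon)-\bm{x}^*\|\le\gamma_1\varepsilon,\qquad \|\bar{\bm{\lambda}}(\varepsilon)-\bm{\lambda}^*\|\le\gamma_2\varepsilon,$$ where $\gamma_1=k_1(k_1+1)\|\bm{\lambda}_0\|$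 and $\gamma_2=\gamma_1\sup_{\|\bm{z}\|\le\delta}\|\nabla^2 f(\bm{x}^*+\bm{z})\|$.
   Context: Setting: $N$ agents, each with a decision variable $x_i\in\mathbb{R}^n$, a cost function $f_i:\mathbb{R}^n\to\mathbb{R}$ and a vector $b_i\in\mathbb{R}^n$. Write $\bm{x}=(x_1^T,\dots,x_N^T)^T$, $\bm{\lambda}=(\lambda_1^T,\dots,\lambda_N^T)^T$, $\bm{b}=(b_1^T,\dots,b_N^T)^T\in\mathbb{R}^{nN}$, $d=\sum_{i=1}^N b_i$, and $1_N=(1,\dots,1)^T\in\mathbb{R}^N$. The resource allocation problem is to minimize $f(\bm{x})=\sum_{i=1}^N f_i(x_i)$ subject to $(1_N^T\otimes I_n)\bm{x}=d$. An equilibrium is a pair satisfying $0=\nabla f(\bm{x})+\bm{\lambda}$ and $0=-\varepsilon(\bm{x}-\bm{b})+\bm{L}\bm{\lambda}$. Graph: $\mathcal{G}$ is a weighted directed graph on $\{1,\dots,N\}$ with adjacency matrix $\mathcal{A}=[a_{ij}]$, where $a_{ij}>0$ if $(j,i)$ is an edge and $a_{ij}=0$ otherwise. Its Laplacian is $L=\mathcal{D}_{in}-\mathcal{A}$ with $\mathcal{D}_{in}=\mathrm{diag}(d_{in}^1,\dots,d_{in}^N)$, $d_{in}^i=\sum_j a_{ij}$. The graph is weight-balanced if $\sum_j a_{ij}=\sum_j a_{ji}$ for all $i$, and strongly connected if there is a directed path between every ordered pair of vertices. $\otimes$ is the Kronecker product, $I_n$ the $n\times n$ identity matrix; $\|\cdot\|$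 is the Euclidean norm and the induced matrix norm. Optimal pair: under the assumptions there is a unique optimal solution $\bm{x}^*$ of the problem, and a unique $\bm{\lambda}^*=1_N\otimes\mu^*$ with $\mu^*\in\mathbb{R}^n$ such that $\nabla f(\bm{x}^* )+\bm{\lambda}^*=0$ (and $(1_N^T\otimes I_n)\bm{x}^*=d$). Constants: - $H=\nabla^2 f(\bm{x}^* )$, and $\bm{r}:\mathbb{R}^{nN}\to\mathbb{R}^{nN}$ is defined by $\nabla f(\bm{x}^*+\bm{z})=\nabla f(\bm{x}^* )+H\bm{z}-\bm{r}(\bm{z})$. - $\bm{\lambda}_0\in\mathbb{R}^{nN}$ is a vector with $\bm{L}\bm{\lambda}_0=\bm{b}-\bm{x}^*$ (such a vector exists). - $k_0>0$ is a constant such that $\|(H+\varepsilon^{-1}H\bm{L}H)^{-1}\|\le k_0(c_0^{-1}+1)$ for all $\varepsilon>0$, and $k_1=(k_0+1)c_0^{-1}+k_0$; with this choice $\|(\varepsilon I_{nN}+\bm{L}H)^{-1}\bm{L}\|\le k_1$ for all $\varepsilon>0$. - $\delta>0$ is such that $\|\bm{r}(\bm{z})-\bm{r}(\bm{z}')\|\le\frac{1}{k_1+1}\|\bm{z}-\bm{z}'\|$ for all $\bm{z},\bm{z}'$ with $\|\bm{z}\|,\|\bm{z}'\|\le\delta$. - $\varepsilon_0>0$ is such that $\varepsilon\|\bm{\lambda}_0\|\le\frac{\delta}{k_1(k_1+1)}$ for all $\varepsilon\in(0,\varepsilon_0)$. Such constants exist, and for every $\varepsilon\in(0,\varepsilon_0)$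 the system has exactly one equilibrium. *)

theory Defs
  imports "HOL-Analysis.Analysis"
begin

text \<open>
  The agents form the finite type \<open>'N\<close> and the coordinates of one decision variable form the
  finite type \<open>'n\<close>. Stacked vectors live in \<open>real ^ ('N \<times> 'n)\<close>, whose entry at \<open>(i, p)\<close> is
  the \<open>p\<close>-th coordinate of the \<open>i\<close>-th block; its norm is the Euclidean norm of the stacked vector.
\<close>

definition block :: "real ^ ('N::finite \<times> 'n::finite) \<Rightarrow> 'N \<Rightarrow> real ^ 'n"
  where "block x i = (\<chi> p. x $ (i, p))"

definition stack :: "('N::finite \<Rightarrow> real ^ 'n) \<Rightarrow> real ^ ('N \<times> 'n)"
  where "stack v = (\<chi> q. v (fst q) $ snd q)"

definition kron :: "real ^ 'b ^ 'a \<Rightarrow> real ^ 'd ^ 'c \<Rightarrow> real ^ ('b \<times> 'd) ^ ('a \<times> 'c)"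
  where "kron A B = (\<chi> r s. A $ fst r $ fst s * B $ snd r $ snd s)"

text \<open>
  Kronecker products with a one-row matrix (\<open>v\<^sup>T \<otimes> B\<close>) and of two column vectors (\<open>v \<otimes> w\<close>).
  The trivial index of \<open>v\<^sup>T\<close>, respectively of the columns, is dropped, so that the results have
  types \<open>real ^ ('b \<times> 'd) ^ 'c\<close> and \<open>real ^ ('b \<times> 'd)\<close>.
\<close>

definition kron_row :: "real ^ 'b \<Rightarrow> real ^ 'd ^ 'c \<Rightarrow> real ^ ('b \<times> 'd) ^ 'c"
  where "kron_row v B = (\<chi> r. kron (rowvector v :: real ^ 'b ^ 1) B $ (1, r))"

definition kron_vec :: "real ^ 'b \<Rightarrow> real ^ 'd \<Rightarrow> real ^ ('b \<times> 'd)"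
  where "kron_vec v w =
    (\<chi> q. kron (columnvector v :: real ^ 1 ^ 'b) (columnvector w :: real ^ 1 ^ 'd) $ q $ (1, 1))"

lemma kron_row_nth: "kron_row v B $ r $ (j, q) = v $ j * B $ r $ q"
  by (simp add: kron_row_def kron_def rowvector_def)

lemma kron_vec_nth: "kron_vec v w $ (j, q) = v $ j * w $ q"
  by (simp add: kron_vec_def kron_def columnvector_def)

definition matrix_norm :: "real ^ 'b ^ 'a \<Rightarrow> real"
  where "matrix_norm A = onorm ((*v) A)"

definition gradient :: "(real ^ 'm \<Rightarrow> real) \<Rightarrow> real ^ 'm \<Rightarrow> real ^ 'm"
  where "gradient f x = (\<chi> i. frechet_derivative f (at x) (axis i 1))"

definition hessian :: "(real ^ 'm \<Rightarrow> real) \<Rightarrow> real ^ 'm \<Rightarrow> real ^ 'm ^ 'm"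
  where "hessian f x = jacobian (gradient f) (at x)"

definition twice_continuously_differentiable :: "(real ^ 'm \<Rightarrow> real) \<Rightarrow> bool"
  where "twice_continuously_differentiable f \<longleftrightarrow>
    (\<forall>x. f differentiable at x) \<and> (\<forall>x. gradient f differentiable at x) \<and>
    continuous_on UNIV (hessian f)"

lemma GDERIV_gradient:
  fixes f :: "real ^ 'm \<Rightarrow> real"
  assumes "f differentiable at x"
  shows "GDERIV f x :> gradient f x"
proof -
  let ?D = "frechet_derivative f (at x)"
  have D: "(f has_derivative ?D) (at x)"
    using assms by (simp add: frechet_derivative_works)
  then interpret linear ?D
    by (rule has_derivative_linear)
  have "?D h = inner h (gradient f x)" for h
  proof -
    have "?D h = ?D (\<Sum>i\<in>UNIV. h $ i *s axis i 1)"
      by (simp add: basis_expansion)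
    also have "\<dots> = (\<Sum>i\<in>UNIV. h $ i * ?D (axis i 1))"
      by (simp add: sum scalar_mult_eq_scaleR scaleR)
    finally show ?thesis
      by (simp add: inner_vec_def gradient_def)
  qed
  then have "?D = (\<lambda>h. inner h (gradient f x))" by auto
  then show ?thesis
    using D by (simp add: gderiv_def)
qed

definition strongly_convex :: "real \<Rightarrow> ('a::real_normed_vector \<Rightarrow> real) \<Rightarrow> bool"
  where "strongly_convex c f \<longleftrightarrow>
    (\<forall>x y. \<forall>t\<in>{0..1}. f (t *\<^sub>R x + (1 - t) *\<^sub>R y)
       \<le> t * f x + (1 - t) * f y - c / 2 * t * (1 - t) * (norm (x - y))\<^sup>2)"

text \<open>An edge \<open>(j, i) \<in> E\<close> points from \<open>j\<close> to \<open>i\<close> and carries the weight \<open>A $ i $ j\<close>.\<close>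

definition weighted_digraph :: "('N \<times> 'N) set \<Rightarrow> real ^ 'N ^ 'N \<Rightarrow> bool"
  where "weighted_digraph E A \<longleftrightarrow>
    (\<forall>i j. if (j, i) \<in> E then A $ i $ j > 0 else A $ i $ j = 0)"

definition strongly_connected_digraph :: "('N \<times> 'N) set \<Rightarrow> bool"
  where "strongly_connected_digraph E \<longleftrightarrow> (\<forall>i j. (i, j) \<in> E\<^sup>*)"

definition weight_balanced :: "real ^ 'N ^ 'N \<Rightarrow> bool"
  where "weight_balanced A \<longleftrightarrow> (\<forall>i. (\<Sum>j\<in>UNIV. A $ i $ j) = (\<Sum>j\<in>UNIV. A $ j $ i))"

definition in_degree_matrix :: "real ^ 'N ^ 'N \<Rightarrow> real ^ 'N ^ 'N"
  where "in_degree_matrix A = (\<chi> i j. if i = j then \<Sum>k\<in>UNIV. A $ i $ k else 0)"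

definition laplacian :: "real ^ 'N ^ 'N \<Rightarrow> real ^ 'N ^ 'N"
  where "laplacian A = in_degree_matrix A - A"

definition total_cost :: "('N::finite \<Rightarrow> real ^ 'n \<Rightarrow> real) \<Rightarrow> real ^ ('N \<times> 'n) \<Rightarrow> real"
  where "total_cost fs x = (\<Sum>i\<in>UNIV. fs i (block x i))"

text \<open>The constraint \<open>(1\<^sub>N\<^sup>T \<otimes> I\<^sub>n) x = d\<close>.\<close>

definition feasible :: "real ^ 'n \<Rightarrow> real ^ ('N::finite \<times> 'n) \<Rightarrow> bool"
  where "feasible d x \<longleftrightarrow> kron_row (vec 1) (mat 1) *v x = d"

text \<open>Rest points of \<open>x' = - \<nabla>f(x) - \<lambda>\<close>, \<open>\<epsilon> \<lambda>' = - L \<lambda> + \<epsilon> (x - b)\<close>.\<close>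

definition is_equilibrium ::
  "(real ^ 'm \<Rightarrow> real) \<Rightarrow> real ^ 'm ^ 'm \<Rightarrow> real ^ 'm \<Rightarrow> real \<Rightarrow> real ^ 'm \<Rightarrow> real ^ 'm \<Rightarrow> bool"
  where "is_equilibrium f L b \<epsilon> x \<mu> \<longleftrightarrow>
    0 = gradient f x + \<mu> \<and> 0 = - (\<epsilon> *\<^sub>R (x - b)) + L *v \<mu>"

end

theory Submission
  imports Defs
begin

text \<open>
  Write an equilibrium as \<open>x = x* + z\<close>, \<open>\<lambda> = - \<nabla>f(x)\<close>. The equilibrium equations become the fixed
  point equation \<open>z = K (\<epsilon> \<lambda>\<^sub>0 + r(z))\<close> with \<open>K = (\<epsilon> I + L H)\<^sup>-\<^sup>1 L\<close>, where \<open>\<parallel>K\<parallel> \<le> k\<^sub>1\<close> and \<open>r\<close> is a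
  \<open>1 / (k\<^sub>1 + 1)\<close>-contraction on the \<open>\<delta>\<close>-ball. Banach's theorem gives a solution \<open>z\<close> in that ball
  with \<open>\<parallel>z\<parallel> \<le> k\<^sub>1 (k\<^sub>1 + 1) \<epsilon> \<parallel>\<lambda>\<^sub>0\<parallel>\<close>. A given equilibrium might a priori lie outside the ball, but
  strong monotonicity of \<open>\<nabla>f\<close> and positive semidefiniteness of \<open>L\<close> make equilibria unique, so it
  is the one just found. The bound on \<open>\<lambda>\<close> is the mean value inequality for \<open>\<nabla>f\<close>.
\<close>

section \<open>Strong convexity: gradient monotonicity and Hessian coercivity\<close>

lemma has_real_derivative_along_line:
  fixes f :: "'a::real_normed_vector \<Rightarrow> real"
  assumes "(f has_derivative D) (at x)"
  shows "((\<lambda>t. f (x + t *\<^sub>R v)) has_real_derivative D v) (at 0)"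
proof -
  interpret bounded_linear D
    using assms by (rule has_derivative_bounded_linear)
  have "((\<lambda>t::real. x + t *\<^sub>R v) has_derivative (\<lambda>t. t *\<^sub>R v)) (at 0)"
    by (auto intro!: derivative_eq_intros)
  moreover have "(f has_derivative D) (at (x + 0 *\<^sub>R v))"
    using assms by simp
  ultimately have "((\<lambda>t. f (x + t *\<^sub>R v)) has_derivative (\<lambda>t. D (t *\<^sub>R v))) (at 0)"
    by (rule has_derivative_compose)
  moreover have "(\<lambda>t. D (t *\<^sub>R v)) = (*) (D v)"
    by (auto simp: scaleR mult.commute)
  ultimately show ?thesis
    by (simp add: has_field_derivative_def)
qed

text \<open>Dividing the defining inequality at \<open>t *\<^sub>R x + (1 - t) *\<^sub>R y\<close>
  by \<open>t\<close> bounds a difference quotient of \<open>f\<close> at \<open>y\<close> in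
  direction \<open>x - y\<close>; the limit t -> 0+ turns it into the directional derivative and the
  factor \<open>1 - t\<close> into 1.\<close>

lemma strongly_convex_gradient_ineq:
  fixes f :: "real ^ 'm \<Rightarrow> real"
  assumes "strongly_convex c f" and "f differentiable at y"
  shows "gradient f y \<bullet> (x - y) + c / 2 * (norm (x - y))\<^sup>2 \<le> f x - f y"
proof -
  let ?n = "(norm (x - y))\<^sup>2"
  let ?q = "\<lambda>t. (f (y + t *\<^sub>R (x - y)) - f y) / t"
  have "(f has_derivative (\<lambda>h. h \<bullet> gradient f y)) (at y)"
    using GDERIV_gradient[OF assms(2)] by (simp add: gderiv_def)
  from has_real_derivative_along_line[OF this, of "x - y"]
  have lim: "(?q \<longlongrightarrow> (x - y) \<bullet> gradient f y) (at_right 0)"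
    by (auto simp: has_field_derivative_iff intro: tendsto_mono[OF at_le])
  have "((\<lambda>t::real. f x - f y - c / 2 * (1 - t) * ?n) \<longlongrightarrow> f x - f y - c / 2 * (1 - 0) * ?n) (at_right 0)"
    by (intro tendsto_intros)
  moreover have "\<forall>\<^sub>F t in at_right 0. ?q t \<le> f x - f y - c / 2 * (1 - t) * ?n"
  proof -
    have "?q t \<le> f x - f y - c / 2 * (1 - t) * ?n" if t: "t \<in> {0<..<1}" for t
    proof -
      have "f (t *\<^sub>R x + (1 - t) *\<^sub>R y) \<le> t * f x + (1 - t) * f y - c / 2 * t * (1 - t) * ?n"
        using assms(1) t by (simp add: strongly_convex_def)
      moreover have "t *\<^sub>R x + (1 - t) *\<^sub>R y = y + t *\<^sub>R (x - y)"
        by (simp add: algebra_simps)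
      ultimately have "f (y + t *\<^sub>R (x - y)) - f y \<le> (f x - f y - c / 2 * (1 - t) * ?n) * t"
        by (simp add: algebra_simps)
      then show ?thesis
        using t by (simp add: pos_divide_le_eq)
    qed
    then show ?thesis
      using eventually_at_right_real[of 0 1] by (auto elim: eventually_mono)
  qed
  ultimately have "(x - y) \<bullet> gradient f y \<le> f x - f y - c / 2 * (1 - 0) * ?n"
    using lim by (intro tendsto_le[OF trivial_limit_at_right_real])
  then show ?thesis
    by (simp add: inner_commute)
qed

text \<open>Sum of the previous inequality and the same one with \<open>x\<close> and
  \<open>y\<close> exchanged: the values of \<open>f\<close> cancel and the two quadratic terms add
  up.\<close>

lemma strongly_convex_gradient_monotone:
  fixes f :: "real ^ 'm \<Rightarrow> real"
  assumes "strongly_convex c f" and "f differentiable at x" and "f differentiable at y"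
  shows "c * (norm (x - y))\<^sup>2 \<le> (gradient f x - gradient f y) \<bullet> (x - y)"
  using strongly_convex_gradient_ineq[OF assms(1,3), of x]
    strongly_convex_gradient_ineq[OF assms(1,2), of y]
  by (simp add: norm_minus_commute[of y x] inner_diff_left inner_diff_right)

lemma has_derivative_gradient:
  fixes f :: "real ^ 'm \<Rightarrow> real"
  assumes "gradient f differentiable at x"
  shows "(gradient f has_derivative (*v) (hessian f x)) (at x)"
  using assms jacobian_works[of "gradient f" "at x"] by (simp add: hessian_def)

text \<open>Monotonicity between \<open>x + t *\<^sub>R v\<close> and \<open>x\<close>, divided by
  t^2, bounds the difference quotient of the gradient in direction \<open>v\<close> from below; the
  limit t -> 0 gives the quadratic form of the Hessian.\<close>

lemma strongly_convex_hessian_coercive: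
  fixes f :: "real ^ 'm \<Rightarrow> real"
  assumes "strongly_convex c f" and "\<And>y. f differentiable at y"
    and "gradient f differentiable at x"
  shows "c * (norm v)\<^sup>2 \<le> (hessian f x *v v) \<bullet> v"
proof -
  let ?q = "\<lambda>t. (gradient f (x + t *\<^sub>R v) \<bullet> v - gradient f x \<bullet> v) / t"
  have "((\<lambda>y. gradient f y \<bullet> v) has_derivative (\<lambda>h. (hessian f x *v h) \<bullet> v)) (at x)"
    using has_derivative_gradient[OF assms(3)] by (rule has_derivative_inner_left)
  from has_real_derivative_along_line[OF this, of v]
  have "(?q \<longlongrightarrow> (hessian f x *v v) \<bullet> v) (at 0)"
    by (simp add: has_field_derivative_iff)
  moreover have "\<forall>\<^sub>F t in at 0. c * (norm v)\<^sup>2 \<le> ?q t"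
  proof -
    have "c * (norm v)\<^sup>2 \<le> ?q t" if "t \<noteq> 0" for t
    proof -
      \<comment> \<open>Keeping the factor t^2 until the cancellation avoids a case split on the
        sign of \<open>t\<close>.\<close>
      have "t\<^sup>2 * (c * (norm v)\<^sup>2) \<le> t * (gradient f (x + t *\<^sub>R v) \<bullet> v - gradient f x \<bullet> v)"
        using strongly_convex_gradient_monotone[OF assms(1,2,2), of "x + t *\<^sub>R v" x]
        by (simp add: power_mult_distrib inner_diff_left mult_ac)
      also have "\<dots> = t\<^sup>2 * ?q t"
        using that by (simp add: power2_eq_square)
      finally show ?thesis
        by (rule mult_left_le_imp_le) (use that in simp)
    qed
    then show ?thesis
      by (auto simp: eventually_at_filter)
  qed
  ultimately show ?thesis
    by (intro tendsto_lowerbound[OF _ _ trivial_limit_at])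
qed

section \<open>Kronecker products and the Laplacian of a weight-balanced graph\<close>

lemma kron_mult_vec_nth:
  "(kron A B *v x) $ (i, p) = (\<Sum>j\<in>UNIV. \<Sum>q\<in>UNIV. A $ i $ j * B $ p $ q * x $ (j, q))"
  by (simp add: matrix_vector_mult_def kron_def sum.cartesian_product case_prod_unfold)

lemma kron_mat_1_mult_vec_nth:
  fixes A :: "real ^ 'b ^ 'a"
  shows "(kron A (mat 1) *v x) $ (i, p) = (\<Sum>j\<in>UNIV. A $ i $ j * x $ (j, p))"
  by (simp add: kron_mult_vec_nth mat_def if_distrib if_distribR cong: if_cong)

lemma kron_row_one_mult_vec_nth:
  fixes x :: "real ^ ('b::finite \<times> 'c::finite)"
  shows "(kron_row (vec 1) (mat 1) *v x) $ p = (\<Sum>j\<in>UNIV. x $ (j, p))"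
proof -
  have "(kron_row (vec 1) (mat 1) *v x) $ p
      = (\<Sum>j\<in>UNIV. \<Sum>q\<in>UNIV. kron_row (vec 1) (mat 1) $ p $ (j, q) * x $ (j, q))"
    by (simp add: matrix_vector_mult_def sum.cartesian_product case_prod_unfold)
  then show ?thesis
    by (simp add: kron_row_nth mat_def if_distrib if_distribR cong: if_cong)
qed

lemma laplacian_nth: "laplacian A $ i $ j = (if i = j then \<Sum>k\<in>UNIV. A $ i $ k else 0) - A $ i $ j"
  by (simp add: laplacian_def in_degree_matrix_def)

lemma laplacian_row_sum: "(\<Sum>j\<in>UNIV. laplacian A $ i $ j) = 0"
  by (simp add: laplacian_nth sum_subtractf)

lemma laplacian_column_sum:
  assumes "weight_balanced A"
  shows "(\<Sum>i\<in>UNIV. laplacian A $ i $ j) = 0"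
  using assms by (simp add: laplacian_nth sum_subtractf weight_balanced_def)

text \<open>For a balanced graph, twice the quadratic form of the Laplacian equals the sum of a_ij
  (y_i - y_j)^2, although the Laplacian need not be symmetric.\<close>

lemma laplacian_quadratic_form_nonneg:
  assumes "weight_balanced A" and nonneg: "\<And>i j. A $ i $ j \<ge> 0"
  shows "(\<Sum>i\<in>UNIV. \<Sum>j\<in>UNIV. y i * (laplacian A $ i $ j * y j)) \<ge> 0"
proof -
  \<comment> \<open>Balance enters here: equal row and column sums of \<open>A\<close> make the two
    sums of squares in the expansion agree.\<close>
  have "(\<Sum>i\<in>UNIV. \<Sum>j\<in>UNIV. A $ i $ j * (y j)\<^sup>2) = (\<Sum>j\<in>UNIV. (\<Sum>i\<in>UNIV. A $ i $ j) * (y j)\<^sup>2)"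
    by (subst sum.swap) (simp add: sum_distrib_right)
  also have "\<dots> = (\<Sum>i\<in>UNIV. \<Sum>j\<in>UNIV. A $ i $ j * (y i)\<^sup>2)"
    using assms(1) by (simp add: weight_balanced_def flip: sum_distrib_right)
  finally have swap: "(\<Sum>i\<in>UNIV. \<Sum>j\<in>UNIV. A $ i $ j * (y j)\<^sup>2)
      = (\<Sum>i\<in>UNIV. \<Sum>j\<in>UNIV. A $ i $ j * (y i)\<^sup>2)" .
  have "0 \<le> (\<Sum>i\<in>UNIV. \<Sum>j\<in>UNIV. A $ i $ j * (y i - y j)\<^sup>2)"
    by (intro sum_nonneg mult_nonneg_nonneg nonneg) auto
  also have "\<dots> = (\<Sum>i\<in>UNIV. \<Sum>j\<in>UNIV.
      A $ i $ j * (y i)\<^sup>2 + A $ i $ j * (y j)\<^sup>2 - 2 * (y i * (A $ i $ j * y j)))"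
    by (simp add: power2_diff algebra_simps)
  also have "\<dots> = 2 * ((\<Sum>i\<in>UNIV. \<Sum>j\<in>UNIV. A $ i $ j * (y i)\<^sup>2)
      - (\<Sum>i\<in>UNIV. \<Sum>j\<in>UNIV. y i * (A $ i $ j * y j)))"
    by (simp add: sum.distrib sum_subtractf swap right_diff_distrib flip: sum_distrib_left)
  also have "(\<Sum>i\<in>UNIV. \<Sum>j\<in>UNIV. A $ i $ j * (y i)\<^sup>2)
      - (\<Sum>i\<in>UNIV. \<Sum>j\<in>UNIV. y i * (A $ i $ j * y j))
      = (\<Sum>i\<in>UNIV. \<Sum>j\<in>UNIV. y i * (laplacian A $ i $ j * y j))"
  proof -
    have "y i * (laplacian A $ i $ j * y j)
        = (if i = j then \<Sum>k\<in>UNIV. A $ i $ k * (y i)\<^sup>2 else 0) - y i * (A $ i $ j * y j)" for i j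
      by (simp add: laplacian_nth power2_eq_square algebra_simps flip: sum_distrib_left)
    then show ?thesis
      by (simp add: sum_subtractf)
  qed
  finally show ?thesis
    by simp
qed

text \<open>The identity factor decouples the coordinates: for each \<open>p\<close> what remains is
  the scalar Laplacian form in the components \<open>x $ (i, p)\<close>.\<close>

lemma inner_kron_laplacian_nonneg:
  fixes x :: "real ^ ('N::finite \<times> 'n::finite)"
  assumes "weight_balanced A" and "\<And>i j. A $ i $ j \<ge> 0"
  shows "x \<bullet> (kron (laplacian A) (mat 1) *v x) \<ge> 0"
proof -
  have "x \<bullet> (kron (laplacian A) (mat 1) *v x)
      = (\<Sum>i\<in>UNIV. \<Sum>p\<in>UNIV. x $ (i, p) * (\<Sum>j\<in>UNIV. laplacian A $ i $ j * x $ (j, p)))"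
    by (simp add: inner_vec_def sum.cartesian_product case_prod_unfold
        flip: kron_mat_1_mult_vec_nth)
  also have "\<dots> = (\<Sum>p\<in>UNIV. \<Sum>i\<in>UNIV. \<Sum>j\<in>UNIV. x $ (i, p) * (laplacian A $ i $ j * x $ (j, p)))"
    by (subst sum.swap) (simp add: sum_distrib_left)
  also have "\<dots> \<ge> 0"
    by (intro sum_nonneg laplacian_quadratic_form_nonneg assms)
  finally show ?thesis .
qed

lemma kron_laplacian_consensus:
  "kron (laplacian A) (mat 1) *v kron_vec (vec 1) w = 0"
  by (auto simp: vec_eq_iff kron_mat_1_mult_vec_nth kron_vec_nth laplacian_row_sum
      simp flip: sum_distrib_right)

text \<open>Balance makes the columns of the Laplacian sum to zero. Applied to the second
  equilibrium equation, this yields feasibility for every positive epsilon.\<close>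

lemma kron_row_kron_laplacian:
  assumes "weight_balanced A"
  shows "kron_row (vec 1) (mat 1) *v (kron (laplacian A) (mat 1) *v x) = 0"
proof -
  have "(\<Sum>i\<in>UNIV. \<Sum>j\<in>UNIV. laplacian A $ i $ j * x $ (j, p)) = 0" for p
    by (subst sum.swap) (simp add: laplacian_column_sum[OF assms] flip: sum_distrib_right)
  then show ?thesis
    unfolding vec_eq_iff kron_row_one_mult_vec_nth kron_mat_1_mult_vec_nth by simp
qed

section \<open>Linear algebra: a bound on the resolvent that is uniform in epsilon\<close>

lemma matrix_inv_inverse:
  assumes "invertible A"
  shows "A ** matrix_inv A = mat 1" and "matrix_inv A ** A = mat 1"
  using someI_ex[OF assms[unfolded invertible_def]] by (auto simp: matrix_inv_def)

lemma matrix_norm_mult_vec: "norm (A *v x) \<le> matrix_norm A * norm x"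
  unfolding matrix_norm_def by (rule onorm) (rule matrix_vector_mul_bounded_linear)

text \<open>Cauchy-Schwarz, followed by cancelling one factor \<open>norm x\<close>. With
  \<open>y\<close> the image of \<open>x\<close> under \<open>H\<close>, it makes \<open>H\<close>
  injective and bounds its inverse by 1/c.\<close>

lemma coercive_norm_le:
  fixes x y :: "'a::real_inner"
  assumes "c * (norm x)\<^sup>2 \<le> y \<bullet> x"
  shows "c * norm x \<le> norm y"
proof (cases "x = 0")
  case False
  have "c * norm x * norm x \<le> norm y * norm x"
    using assms norm_cauchy_schwarz[of y x] by (simp add: power2_eq_square)
  then show ?thesis
    using False by simp
qed simp

text \<open>
  With \<open>M = H + H L H / e\<close> one has \<open>(e I + L H)\<^sup>-\<^sup>1 L = H\<^sup>-\<^sup>1 - M\<^sup>-\<^sup>1\<close>; this is the matrix \<open>K\<close>.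
\<close>

lemma resolvent_bound:
  fixes H L :: "real ^ 'm ^ 'm"
  assumes "c > 0" and coercive: "\<And>v. c * (norm v)\<^sup>2 \<le> (H *v v) \<bullet> v"
    and psd: "\<And>v. v \<bullet> (L *v v) \<ge> 0" and "e > 0"
    and bound: "matrix_norm (matrix_inv (H + (1 / e) *\<^sub>R (H ** L ** H))) \<le> k"
  obtains K :: "real ^ 'm ^ 'm"
  where "\<And>w. norm (K *v w) \<le> (1 / c + k) * norm w"
    and "\<And>w. e *\<^sub>R (K *v w) + L *v (H *v (K *v w)) = L *v w"
proof
  define M where "M = H + (1 / e) *\<^sub>R (H ** L ** H)"
  have Mv: "M *v v = H *v (v + (1 / e) *\<^sub>R (L *v (H *v v)))" for v
    by (simp only: M_def matrix_vector_mult_add_rdistrib matrix_vector_right_distrib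
        matrix_vector_mult_scaleR matrix_vector_mul_assoc matrix_mul_assoc
        flip: scaleR_matrix_vector_assoc)
  have H_norm: "c * norm v \<le> norm (H *v v)" for v
    using coercive by (rule coercive_norm_le)
  have H_ker: "v = 0" if "H *v v = 0" for v
    using H_norm[of v] that \<open>c > 0\<close> by (simp add: mult_le_0_iff)
  \<comment> \<open>Injectivity of \<open>H\<close> removes the outer factor of \<open>M\<close>.
    Pairing the rest with \<open>H *v v\<close> leaves a coercive term plus a nonnegative one, since
    \<open>L\<close> is positive semidefinite.\<close>
  have M_ker: "v = 0" if "M *v v = 0" for v
  proof -
    have "v + (1 / e) *\<^sub>R (L *v (H *v v)) = 0"
      by (rule H_ker) (use that in \<open>simp only: Mv\<close>)
    then have "(H *v v) \<bullet> v + (1 / e) * ((H *v v) \<bullet> (L *v (H *v v))) = 0"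
      by (metis inner_add_right inner_scaleR_right inner_zero_right)
    moreover have "(1 / e) * ((H *v v) \<bullet> (L *v (H *v v))) \<ge> 0"
      using \<open>e > 0\<close> psd by simp
    ultimately have "c * (norm v)\<^sup>2 \<le> 0"
      using coercive[of v] by linarith
    then show ?thesis
      using \<open>c > 0\<close> by (simp add: mult_le_0_iff)
  qed
  have "invertible H" "invertible M"
    unfolding invertible_left_inverse matrix_left_invertible_ker using H_ker M_ker by blast+
  then have H_inv: "H *v (matrix_inv H *v w) = w" and M_inv: "M *v (matrix_inv M *v w) = w" for w
    by (simp_all add: matrix_vector_mul_assoc matrix_inv_inverse)
  define K where "K = matrix_inv H - matrix_inv M"
  have K: "K *v w = matrix_inv H *v w - matrix_inv M *v w" for w
    by (simp add: K_def matrix_vector_mult_diff_rdistrib)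
  show "norm (K *v w) \<le> (1 / c + k) * norm w" for w
  proof -
    have "norm (matrix_inv H *v w) \<le> 1 / c * norm w"
      using H_norm[of "matrix_inv H *v w"] \<open>c > 0\<close> by (simp add: H_inv field_simps)
    moreover have "norm (matrix_inv M *v w) \<le> k * norm w"
      using order_trans[OF matrix_norm_mult_vec mult_right_mono[OF bound norm_ge_zero]]
      by (simp add: M_def)
    ultimately have "norm (K *v w) \<le> 1 / c * norm w + k * norm w"
      unfolding K by (intro order_trans[OF norm_triangle_ineq4] add_mono)
    then show ?thesis
      by (simp add: distrib_right)
  qed
  show "e *\<^sub>R (K *v w) + L *v (H *v (K *v w)) = L *v w" for w
  proof -
    let ?z = "K *v w"
    \<comment> \<open>As M H^-1 = I + H L / e, the right side collapses to H L w / e. Cancelling the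
      injective \<open>H\<close> and multiplying by \<open>e\<close> gives the claimed
      identity.\<close>
    have "M *v ?z = M *v (matrix_inv H *v w) - w"
      by (simp add: K matrix_vector_mult_diff_distrib M_inv)
    also have "\<dots> = H *v ((1 / e) *\<^sub>R (L *v w))"
      by (simp add: Mv H_inv matrix_vector_right_distrib)
    finally have "H *v (?z + (1 / e) *\<^sub>R (L *v (H *v ?z)) - (1 / e) *\<^sub>R (L *v w)) = 0"
      by (simp add: Mv matrix_vector_mult_diff_distrib)
    then have "?z + (1 / e) *\<^sub>R (L *v (H *v ?z)) - (1 / e) *\<^sub>R (L *v w) = 0"
      by (rule H_ker)
    then have "e *\<^sub>R (?z + (1 / e) *\<^sub>R (L *v (H *v ?z)) - (1 / e) *\<^sub>R (L *v w)) = 0"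
      by simp
    then show ?thesis
      using \<open>e > 0\<close> by (simp add: scaleR_add_right scaleR_diff_right)
  qed
qed

section \<open>Uniqueness of equilibria and the fixed point argument\<close>

text \<open>The second equation gives L(mu - nu) = e(x - y), so semidefiniteness makes the inner
  product of mu - nu and x - y nonnegative. By the first equation mu - nu is minus the gradient
  difference, so strong monotonicity forces \<open>x = y\<close>.\<close>

lemma equilibrium_unique:
  fixes f :: "real ^ 'm \<Rightarrow> real"
  assumes "c > 0" and "strongly_convex c f" and "\<And>x. f differentiable at x"
    and psd: "\<And>v. v \<bullet> (L *v v) \<ge> 0" and "e > 0"
    and eq: "is_equilibrium f L b e x \<mu>" "is_equilibrium f L b e y \<nu>"
  shows "x = y"
proof -
  have \<mu>\<nu>: "\<mu> - \<nu> = - (gradient f x - gradient f y)"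
    using eq unfolding is_equilibrium_def by (metis neg_eq_iff_add_eq_0 minus_diff_minus)
  have "L *v \<mu> = e *\<^sub>R (x - b)" "L *v \<nu> = e *\<^sub>R (y - b)"
    using eq by (simp_all add: is_equilibrium_def)
  then have "L *v (\<mu> - \<nu>) = e *\<^sub>R (x - y)"
    by (simp add: matrix_vector_mult_diff_distrib scaleR_diff_right)
  then have "0 \<le> e * ((\<mu> - \<nu>) \<bullet> (x - y))"
    using psd[of "\<mu> - \<nu>"] by simp
  then have "(gradient f x - gradient f y) \<bullet> (x - y) \<le> 0"
    using \<open>e > 0\<close> by (simp add: \<mu>\<nu> zero_le_mult_iff inner_diff_left)
  then have "c * (norm (x - y))\<^sup>2 \<le> 0"
    using strongly_convex_gradient_monotone[OF assms(2,3,3)] order_trans by blast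
  then show ?thesis
    using \<open>c > 0\<close> by (simp add: mult_le_0_iff)
qed

lemma perturbed_linear_fixpoint:
  fixes K :: "'a::banach \<Rightarrow> 'a"
  assumes K: "linear K" and K_bound: "\<And>w. norm (K w) \<le> k * norm w" and "k > 0"
    and r0: "r 0 = 0" and "\<delta> \<ge> 0"
    and r: "\<And>z z'. norm z \<le> \<delta> \<Longrightarrow> norm z' \<le> \<delta> \<Longrightarrow> norm (r z - r z') \<le> 1 / (k + 1) * norm (z - z')"
    and v: "norm v \<le> \<delta> / (k * (k + 1))"
  obtains z where "norm z \<le> k * (k + 1) * norm v" and "K (v + r z) = z"
proof -
  interpret linear K by (rule K)
  let ?T = "\<lambda>z. K (v + r z)"
  have r_le: "norm (r z) \<le> norm z / (k + 1)" if "norm z \<le> \<delta>" for z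
    using r[OF that, of 0] \<open>\<delta> \<ge> 0\<close> r0 by simp
  \<comment> \<open>This estimate serves twice: for the invariance of the ball and for the size of
    the fixed point.\<close>
  have T_le: "norm (?T z) \<le> k * norm v + k / (k + 1) * norm z" if "norm z \<le> \<delta>" for z
  proof -
    have "norm (v + r z) \<le> norm v + norm z / (k + 1)"
      using norm_triangle_ineq[of v "r z"] r_le[OF that] by linarith
    then have "k * norm (v + r z) \<le> k * (norm v + norm z / (k + 1))"
      using \<open>k > 0\<close> by (intro mult_left_mono) auto
    then show ?thesis
      using K_bound[of "v + r z"] by (simp add: distrib_left)
  qed
  have "\<exists>!z\<in>cball 0 \<delta>. ?T z = z"
  proof (rule Banach_fix)
    show "?T ` cball 0 \<delta> \<subseteq> cball 0 \<delta>"
    proof clarsimp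
      fix z :: 'a assume z: "norm z \<le> \<delta>"
      have "k * norm v \<le> k * (\<delta> / (k * (k + 1)))"
        using v \<open>k > 0\<close> by (intro mult_left_mono) auto
      moreover have "k / (k + 1) * norm z \<le> k / (k + 1) * \<delta>"
        using z \<open>k > 0\<close> by (intro mult_left_mono) auto
      \<comment> \<open>The threshold on \<open>norm v\<close> is chosen for this identity: the
        share \<delta>/(k+1) from \<open>v\<close> and the share k\<delta>/(k+1) from
        \<open>r\<close> fill the radius exactly.\<close>
      moreover have "k * (\<delta> / (k * (k + 1))) + k / (k + 1) * \<delta> = \<delta>"
        using \<open>k > 0\<close> by (simp add: divide_simps) (simp add: algebra_simps)
      ultimately show "norm (?T z) \<le> \<delta>"
        using T_le[OF z] by linarith
    qed
    show "dist (?T z) (?T z') \<le> k / (k + 1) * dist z z'"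
      if "z \<in> cball 0 \<delta>" "z' \<in> cball 0 \<delta>" for z z'
    proof -
      have "norm (?T z - ?T z') = norm (K (r z - r z'))"
        by (simp flip: diff)
      also have "\<dots> \<le> k * (1 / (k + 1) * norm (z - z'))"
        using \<open>k > 0\<close> that by (intro order_trans[OF K_bound] mult_left_mono r) auto
      finally show ?thesis
        by (simp add: dist_norm)
    qed
  qed (use \<open>k > 0\<close> \<open>\<delta> \<ge> 0\<close> in \<open>auto simp: complete_eq_closed\<close>)
  then obtain z where z: "norm z \<le> \<delta>" and fixpoint: "?T z = z"
    by auto
  \<comment> \<open>Absorbing the last term leaves \<open>norm z / (k + 1)\<close> on the left,
    whence the factor k(k+1).\<close>
  have "norm z \<le> k * norm v + k / (k + 1) * norm z"
    using T_le[OF z] fixpoint by simp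
  then have "norm z \<le> k * (k + 1) * norm v"
    using \<open>k > 0\<close> by (simp add: field_simps)
  with fixpoint show ?thesis
    using that by blast
qed

section \<open>Hessian norms on a ball and the mean value inequality\<close>

text \<open>Ensures that the supremum in \<open>\<gamma>2\<close> is a genuine least upper bound.
  The sum of absolute entries dominates the operator norm and is continuous, hence bounded on a
  compact set.\<close>

lemma bdd_above_matrix_norm:
  fixes A :: "'a::topological_space \<Rightarrow> real ^ 'c ^ 'b"
  assumes "continuous_on S A" and "compact S"
  shows "bdd_above ((\<lambda>z. matrix_norm (A z)) ` S)"
proof -
  have "continuous_on S (\<lambda>z. \<Sum>i\<in>UNIV. \<Sum>j\<in>UNIV. \<bar>A z $ i $ j\<bar>)"
    using assms(1) by (intro continuous_intros)
  then have "bdd_above ((\<lambda>z. \<Sum>i\<in>UNIV. \<Sum>j\<in>UNIV. \<bar>A z $ i $ j\<bar>) ` S)"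
    using assms(2) by (intro bounded_imp_bdd_above compact_imp_bounded compact_continuous_image)
  then obtain B where "\<And>z. z \<in> S \<Longrightarrow> (\<Sum>i\<in>UNIV. \<Sum>j\<in>UNIV. \<bar>A z $ i $ j\<bar>) \<le> B"
    by (auto simp: bdd_above_def)
  then show ?thesis
    unfolding matrix_norm_def
    by (intro bdd_aboveI2[of _ _ B]) (rule order_trans[OF onorm_le_matrix_component_sum])
qed

lemma bdd_above_hessian_norm:
  fixes f :: "real ^ 'm \<Rightarrow> real"
  assumes "twice_continuously_differentiable f"
  shows "bdd_above ((\<lambda>z. matrix_norm (hessian f (x + z))) ` cball 0 \<delta>)"
proof -
  have "continuous_on (cball 0 \<delta>) (\<lambda>z. hessian f (x + z))"
    using assms unfolding twice_continuously_differentiable_def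
    by (auto intro!: continuous_on_compose2[of UNIV "hessian f"] continuous_intros)
  then show ?thesis
    by (intro bdd_above_matrix_norm compact_cball)
qed

lemma gradient_diff_le_SUP_hessian:
  fixes f :: "real ^ 'm \<Rightarrow> real"
  assumes "twice_continuously_differentiable f" and "norm z \<le> \<delta>"
  shows "norm (gradient f (x + z) - gradient f x)
    \<le> (SUP z\<in>cball 0 \<delta>. matrix_norm (hessian f (x + z))) * norm z"
proof -
  have diff: "gradient f differentiable at y" for y
    using assms(1) by (simp add: twice_continuously_differentiable_def)
  have "\<delta> \<ge> 0"
    using assms(2) norm_ge_zero order_trans by blast
  have "norm (gradient f (x + z) - gradient f x)
    \<le> (SUP z\<in>cball 0 \<delta>. matrix_norm (hessian f (x + z))) * norm (x + z - x)"
  proof (rule differentiable_bound[of "cball x \<delta>"])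
    show "(gradient f has_derivative (*v) (hessian f y)) (at y within cball x \<delta>)" for y
      using has_derivative_gradient[OF diff] by (rule has_derivative_at_withinI)
    show "onorm ((*v) (hessian f y)) \<le> (SUP z\<in>cball 0 \<delta>. matrix_norm (hessian f (x + z)))"
      if "y \<in> cball x \<delta>" for y
      using cSUP_upper[OF _ bdd_above_hessian_norm[OF assms(1)], of "y - x" \<delta> x] that
      by (simp add: matrix_norm_def dist_norm norm_minus_commute)
  qed (use assms(2) \<open>\<delta> \<ge> 0\<close> in \<open>auto simp: dist_norm\<close>)
  then show ?thesis
    by simp
qed

section \<open>Assembly: feasibility, error bounds and the limit\<close>

theorem theorem3:
  fixes fs :: "'N::finite \<Rightarrow> real ^ 'n::finite \<Rightarrow> real"
    and bs :: "'N \<Rightarrow> real ^ 'n"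
    and E :: "('N \<times> 'N) set"
    and A :: "real ^ 'N ^ 'N"
    and f :: "real ^ ('N \<times> 'n) \<Rightarrow> real"
    and L H :: "real ^ ('N \<times> 'n) ^ ('N \<times> 'n)"
    and b xstar lamstar lam0 :: "real ^ ('N \<times> 'n)"
    and d mustar :: "real ^ 'n"
    and r :: "real ^ ('N \<times> 'n) \<Rightarrow> real ^ ('N \<times> 'n)"
    and c0 k0 k1 \<delta> \<epsilon>0 \<gamma>1 \<gamma>2 :: real
    and xbar lambar :: "real \<Rightarrow> real ^ ('N \<times> 'n)"
  assumes f: "f = total_cost fs"
    and b: "b = stack bs"
    and d: "d = (\<Sum>i\<in>UNIV. bs i)"
    and c0: "c0 > 0"
    and convex: "strongly_convex c0 f"
    and smooth: "twice_continuously_differentiable f"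
    and graph: "weighted_digraph E A"
    and connected: "strongly_connected_digraph E"
    and balanced: "weight_balanced A"
    and L: "L = kron (laplacian A) (mat 1)"
    and xstar: "is_arg_min f (feasible d) xstar"
    and lamstar: "lamstar = kron_vec (vec 1) mustar"
    and optimality: "gradient f xstar + lamstar = 0"
    and H: "H = hessian f xstar"
    and r: "\<And>z. gradient f (xstar + z) = gradient f xstar + H *v z - r z"
    and lam0: "L *v lam0 = b - xstar"
    and k0: "k0 > 0"
    and k0_bound: "\<And>\<epsilon>. \<epsilon> > 0 \<Longrightarrow>
          matrix_norm (matrix_inv (H + (1 / \<epsilon>) *\<^sub>R (H ** L ** H))) \<le> k0 * (1 / c0 + 1)"
    and k1: "k1 = (k0 + 1) * (1 / c0) + k0"
    and \<delta>: "\<delta> > 0"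
    and r_lipschitz: "\<And>z z'. norm z \<le> \<delta> \<Longrightarrow> norm z' \<le> \<delta> \<Longrightarrow>
          norm (r z - r z') \<le> 1 / (k1 + 1) * norm (z - z')"
    and \<epsilon>0: "\<epsilon>0 > 0"
    and \<epsilon>0_bound: "\<And>\<epsilon>. \<epsilon> \<in> {0<..<\<epsilon>0} \<Longrightarrow> \<epsilon> * norm lam0 \<le> \<delta> / (k1 * (k1 + 1))"
    and equilibrium: "\<And>\<epsilon>. \<epsilon> \<in> {0<..<\<epsilon>0} \<Longrightarrow> is_equilibrium f L b \<epsilon> (xbar \<epsilon>) (lambar \<epsilon>)"
    and \<gamma>1: "\<gamma>1 = k1 * (k1 + 1) * norm lam0"
    and \<gamma>2: "\<gamma>2 = \<gamma>1 * (SUP z\<in>cball 0 \<delta>. matrix_norm (hessian f (xstar + z)))"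
  shows "(\<forall>\<epsilon>\<in>{0<..<\<epsilon>0}. kron_row (vec 1) (mat 1) *v xbar \<epsilon> = d) \<and>
         ((\<lambda>\<epsilon>. (xbar \<epsilon>, lambar \<epsilon>)) \<longlongrightarrow> (xstar, lamstar)) (at_right 0) \<and>
         (\<forall>\<epsilon>\<in>{0<..<\<epsilon>0}. norm (xbar \<epsilon> - xstar) \<le> \<gamma>1 * \<epsilon> \<and>
                         norm (lambar \<epsilon> - lamstar) \<le> \<gamma>2 * \<epsilon>)"
proof -
  let ?G = "SUP z\<in>cball 0 \<delta>. matrix_norm (hessian f (xstar + z))"
  have diff: "f differentiable at x" "gradient f differentiable at x" for x
    using smooth by (simp_all add: twice_continuously_differentiable_def)
  have nonneg: "A $ i $ j \<ge> 0" for i j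
    using graph unfolding weighted_digraph_def by (metis less_eq_real_def)
  have psd: "v \<bullet> (L *v v) \<ge> 0" for v
    unfolding L using balanced nonneg by (rule inner_kron_laplacian_nonneg)
  have coercive: "c0 * (norm v)\<^sup>2 \<le> (H *v v) \<bullet> v" for v
    unfolding H using convex diff by (rule strongly_convex_hessian_coercive)
  have L_lamstar: "L *v lamstar = 0"
    unfolding L lamstar by (rule kron_laplacian_consensus)
  \<comment> \<open>\<open>k1\<close> is the sum of the bounds for the inverses of \<open>H\<close>
    and of H + H L H / epsilon, that is, the constant supplied by
    \<open>resolvent_bound\<close>.\<close>
  have k1_eq: "1 / c0 + k0 * (1 / c0 + 1) = k1"
    unfolding k1 by (simp add: algebra_simps add_divide_distrib)
  have "k1 > 0"
    using k0 c0 unfolding k1 by (intro add_pos_pos mult_pos_pos) auto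
  have r0: "r 0 = 0"
    using r[of 0] by simp

  have feasible: "kron_row (vec 1) (mat 1) *v xbar e = d" if e: "e \<in> {0<..<\<epsilon>0}" for e
  proof -
    have "e *\<^sub>R (xbar e - b) = L *v lambar e"
      using equilibrium[OF e] by (simp add: is_equilibrium_def)
    then have "kron_row (vec 1) (mat 1) *v (e *\<^sub>R (xbar e - b)) = 0"
      using kron_row_kron_laplacian[OF balanced] unfolding L by metis
    then have "kron_row (vec 1) (mat 1) *v xbar e = kron_row (vec 1) (mat 1) *v b"
      using e by (simp add: matrix_vector_mult_scaleR matrix_vector_mult_diff_distrib)
    also have "\<dots> = d"
      unfolding vec_eq_iff kron_row_one_mult_vec_nth b d by (simp add: stack_def)
    finally show ?thesis .
  qed

  have bounds: "norm (xbar e - xstar) \<le> \<gamma>1 * e \<and> norm (lambar e - lamstar) \<le> \<gamma>2 * e"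
    if e: "e \<in> {0<..<\<epsilon>0}" for e
  proof -
    have "e > 0"
      using e by simp
    obtain K :: "real ^ ('N \<times> 'n) ^ ('N \<times> 'n)"
      where K_bound: "norm (K *v w) \<le> k1 * norm w"
        and K: "e *\<^sub>R (K *v w) + L *v (H *v (K *v w)) = L *v w" for w
      using resolvent_bound[OF c0 coercive psd \<open>e > 0\<close> k0_bound[OF \<open>e > 0\<close>]]
      unfolding k1_eq by metis
    have small: "norm (e *\<^sub>R lam0) \<le> \<delta> / (k1 * (k1 + 1))"
      using \<epsilon>0_bound[OF e] \<open>e > 0\<close> by simp
    obtain z where z: "norm z \<le> k1 * (k1 + 1) * norm (e *\<^sub>R lam0)"
      and fixpoint: "K *v (e *\<^sub>R lam0 + r z) = z"
      by (rule perturbed_linear_fixpoint[where K = "(*v) K" and r = r,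
            OF matrix_vector_mul_linear K_bound \<open>k1 > 0\<close> r0 less_imp_le[OF \<delta>] r_lipschitz small])
    \<comment> \<open>Expanding the gradient by \<open>r\<close> and using that \<open>L\<close>
      annihilates \<open>lamstar\<close> leaves L r(z) - L H z. The identity for \<open>K\<close> at
      w = e lam0 + r(z), where K w = z, evaluates this to e z - e L lam0, and \<open>lam0\<close>
      was chosen so that the latter is e(x - b).\<close>
    have "is_equilibrium f L b e (xstar + z) (- gradient f (xstar + z))"
    proof -
      have "- gradient f (xstar + z) = lamstar - H *v z + r z"
        using optimality by (simp add: r add_eq_0_iff)
      then have "L *v (- gradient f (xstar + z)) = L *v r z - L *v (H *v z)"
        by (simp only: matrix_vector_mult_diff_distrib matrix_vector_right_distrib L_lamstar) simp
      also have "\<dots> = e *\<^sub>R z - e *\<^sub>R (L *v lam0)"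
        using K[of "e *\<^sub>R lam0 + r z", unfolded fixpoint] by (simp add: algebra_simps)
      also have "\<dots> = e *\<^sub>R (xstar + z - b)"
        by (simp add: lam0 algebra_simps)
      finally show ?thesis
        by (simp add: is_equilibrium_def)
    qed
    with equilibrium[OF e] have x: "xbar e = xstar + z"
      by (intro equilibrium_unique[OF c0 convex diff(1) psd \<open>e > 0\<close>])
    have x_bound: "norm z \<le> \<gamma>1 * e"
      using z \<open>e > 0\<close> by (simp add: \<gamma>1 mult_ac)
    \<comment> \<open>The size bound on \<open>z\<close> and the smallness of epsilon put
      \<open>z\<close> back into the \<delta>-ball, over which the supremum is taken.\<close>
    have "k1 * (k1 + 1) * norm (e *\<^sub>R lam0) \<le> k1 * (k1 + 1) * (\<delta> / (k1 * (k1 + 1)))"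
      using \<open>k1 > 0\<close> small by (intro mult_left_mono) auto
    then have z_\<delta>: "norm z \<le> \<delta>"
      using z \<open>k1 > 0\<close> by simp
    \<comment> \<open>The centre of the ball shows that the supremum is nonnegative, so that
      multiplying the bound on \<open>norm z\<close> by it preserves the inequality.\<close>
    have "matrix_norm H \<le> ?G"
      using cSUP_upper[OF _ bdd_above_hessian_norm[OF smooth], of 0 \<delta> xstar] \<delta> by (simp add: H)
    then have "?G \<ge> 0"
      using onorm_pos_le[OF matrix_vector_mul_bounded_linear, of H] by (simp add: matrix_norm_def)
    have "lambar e - lamstar = - (gradient f (xstar + z) - gradient f xstar)"
      using equilibrium[OF e] optimality
      unfolding is_equilibrium_def x by (metis neg_eq_iff_add_eq_0 minus_diff_minus)
    then have "norm (lambar e - lamstar) \<le> ?G * norm z"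
      using gradient_diff_le_SUP_hessian[OF smooth z_\<delta>, of xstar] by (simp only: norm_minus_cancel)
    also have "\<dots> \<le> ?G * (\<gamma>1 * e)"
      using x_bound \<open>?G \<ge> 0\<close> by (rule mult_left_mono)
    finally show ?thesis
      using x_bound by (simp add: x \<gamma>2 mult_ac)
  qed

  have small_e: "\<forall>\<^sub>F e in at_right 0. e \<in> {0<..<\<epsilon>0}"
    using \<epsilon>0 by (rule eventually_at_right_real)
  \<comment> \<open>An error bound linear in epsilon forces convergence; this is used for both
    components of the pair.\<close>
  have lim: "(y \<longlongrightarrow> l) (at_right 0)"
    if "\<And>e. e \<in> {0<..<\<epsilon>0} \<Longrightarrow> norm (y e - l) \<le> g * e" for y :: "real \<Rightarrow> real ^ ('N \<times> 'n)" and l g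
  proof (rule LIM_zero_cancel, rule Lim_null_comparison)
    show "\<forall>\<^sub>F e in at_right 0. norm (y e - l) \<le> g * e"
      using small_e by (rule eventually_mono) (rule that)
    show "((\<lambda>e. g * e) \<longlongrightarrow> 0) (at_right 0)"
      by (auto intro!: tendsto_eq_intros)
  qed
  have "((\<lambda>e. (xbar e, lambar e)) \<longlongrightarrow> (xstar, lamstar)) (at_right 0)"
    using bounds by (intro tendsto_Pair lim) blast+
  then show ?thesis
    using feasible bounds by blast
qed

end
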